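(* Let $F:\mathbb{R}^2\to\mathbb{R}^2$ be of class $C^r$ ($r\ge 1$) near the origin and let $(0,0)$ be a hyperbolic fixed point of the system $(x,y)\mapsto F(x,y)$ having an eigenvalue $\lambda_1$ with $|\lambda_1|<1$ and a local stable manifold which is a graph $y=h(x)$, where $h$ is of class $C^r$ near $0$ and $h(0)=h'(0)=0$. Let the restriction of the system to the stable manifold be given by $$x\mapsto G(x)=\lambda_1 x+f(x,h(x)),$$ where the Taylor expansion of $f$ at the origin starts with at least quadratic terms. Let $S(x_1,y_1)=\{(x_n,y_n)\}_{n\in\mathbb{N}}$ be the orbit of the system on the stable manifold, given by $$x_{n+1}=\lambda_1x_n+f(x_n,h(x_n)),\qquad y_{n+1}=h(x_{n+1}),$$ with initial point $(x_1,y_1)$ on the stable manifold, $y_1=h(x_1)$. Then there exists $\rho>0$ such that for $\|(x_1,y_1)\|<\rho$ we have $\dim_B S(x_1,y_1)=0$.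
   Context: A fixed point is hyperbolic if no eigenvalue of the Jacobi matrix there has modulus $1$. An orbit is identified with its set of points. Box dimension: for a bounded set $A\subset\mathbb{R}^N$ let $A_\varepsilon=\{y\in\mathbb{R}^N: d(y,A)<\varepsilon\}$ and let $|A_\varepsilon|$ be its Lebesgue measure. For $s\ge 0$ put $\mathcal{M}_*^s(A)=\liminf_{\varepsilon\to0}|A_\varepsilon|/\varepsilon^{N-s}$ and $\mathcal{M}^{*s}(A)=\limsup_{\varepsilon\to0}|A_\varepsilon|/\varepsilon^{N-s}$. The lower and upper box dimensions are $\underline{\dim}_B A=\inf\{s>0:\mathcal{M}_*^s(A)=0\}$ and $\overline{\dim}_B A=\inf\{s>0:\mathcal{M}^{*s}(A)=0\}$; if they coincide, the common value is denoted $\dim_B A$. The assertion $\dim_B A=d$ includes that both coincide. "The Taylor expansion of $f$ starts with at least quadratic terms" means that $f$ and its first-order partial derivatives vanish at the origin. *)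

theory Defs
  imports "HOL-Analysis.Analysis"
begin

fun class_C_on :: "nat \<Rightarrow> 'a::real_normed_vector set \<Rightarrow> ('a \<Rightarrow> 'b::real_normed_vector) \<Rightarrow> bool" where
  "class_C_on 0 S f \<longleftrightarrow> continuous_on S f"
| "class_C_on (Suc k) S f \<longleftrightarrow>
     (\<forall>x\<in>S. f differentiable (at x)) \<and>
     (\<forall>v. class_C_on k S (\<lambda>x. frechet_derivative f (at x) v))"

definition class_C_near :: "nat \<Rightarrow> ('a::real_normed_vector \<Rightarrow> 'b::real_normed_vector) \<Rightarrow> 'a \<Rightarrow> bool" where
  "class_C_near k f a \<longleftrightarrow> (\<exists>S. open S \<and> a \<in> S \<and> class_C_on k S f)"

definition complex_eigenvalue :: "real^'n^'n \<Rightarrow> complex \<Rightarrow> bool" where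
  "complex_eigenvalue A \<mu> \<longleftrightarrow> (\<exists>v::complex^'n. v \<noteq> 0 \<and> map_matrix complex_of_real A *v v = \<mu> *s v)"

definition hyperbolic_fixed_point :: "(real^'n \<Rightarrow> real^'n) \<Rightarrow> real^'n \<Rightarrow> bool" where
  "hyperbolic_fixed_point F p \<longleftrightarrow>
     F p = p \<and> F differentiable (at p) \<and>
     (\<forall>\<mu>. complex_eigenvalue (jacobian F (at p)) \<mu> \<longrightarrow> cmod \<mu> \<noteq> 1)"

definition local_stable_manifold :: "('a::topological_space \<Rightarrow> 'a) \<Rightarrow> 'a \<Rightarrow> 'a set \<Rightarrow> 'a set" where
  "local_stable_manifold F p U =
     {q. (\<forall>n. (F ^^ n) q \<in> U) \<and> (\<lambda>n. (F ^^ n) q) \<longlonglongrightarrow> p}"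

(* infdist y {} = 0, whereas the distance to the empty set should be infinite; hence the guard. *)
definition eps_nbhd :: "'a::metric_space set \<Rightarrow> real \<Rightarrow> 'a set" where
  "eps_nbhd A \<epsilon> = {y. A \<noteq> {} \<and> infdist y A < \<epsilon>}"

definition lower_minkowski_content :: "real \<Rightarrow> 'a::euclidean_space set \<Rightarrow> ennreal" where
  "lower_minkowski_content s A =
     Liminf (at_right 0) (\<lambda>\<epsilon>. emeasure lebesgue (eps_nbhd A \<epsilon>) / ennreal (\<epsilon> powr (real DIM('a) - s)))"

definition upper_minkowski_content :: "real \<Rightarrow> 'a::euclidean_space set \<Rightarrow> ennreal" where
  "upper_minkowski_content s A =
     Limsup (at_right 0) (\<lambda>\<epsilon>. emeasure lebesgue (eps_nbhd A \<epsilon>) / ennreal (\<epsilon> powr (real DIM('a) - s)))"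

definition lower_box_dim :: "'a::euclidean_space set \<Rightarrow> ereal" where
  "lower_box_dim A = (INF s\<in>{s. 0 < s \<and> lower_minkowski_content s A = 0}. ereal s)"

definition upper_box_dim :: "'a::euclidean_space set \<Rightarrow> ereal" where
  "upper_box_dim A = (INF s\<in>{s. 0 < s \<and> upper_minkowski_content s A = 0}. ereal s)"

definition has_box_dim :: "'a::euclidean_space set \<Rightarrow> real \<Rightarrow> bool" where
  "has_box_dim A d \<longleftrightarrow> bounded A \<and> lower_box_dim A = ereal d \<and> upper_box_dim A = ereal d"

end

theory Submission
  imports Defs "HOL-Real_Asymp.Real_Asymp"
begin

text \<open>The restriction \<open>G\<close> has derivative \<open>\<lambda>\<^sub>1\<close> at 0, so orbits on the stable manifold
  converge to the origin geometrically. Hence, up to \<open>O(ln (1/\<epsilon>))\<close> points, the orbit lies within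
  \<open>\<epsilon>\<close> of the origin, its \<open>\<epsilon>\<close>-neighbourhood has measure \<open>O(\<epsilon>\<^sup>N ln (1/\<epsilon>))\<close>, and the
  Minkowski content vanishes for every \<open>s > 0\<close>.\<close>

text \<open>The lower content is squeezed between 0 and the upper one, so both index sets become
  \<open>{0<..}\<close>, whose infimum 0 is not attained.\<close>

lemma has_box_dim_0I:
  fixes A :: "'a::euclidean_space set"
  assumes "bounded A" and up: "\<And>s. 0 < s \<Longrightarrow> upper_minkowski_content s A = 0"
  shows "has_box_dim A 0"
proof -
  have le: "lower_minkowski_content s A \<le> upper_minkowski_content s A" for s
    unfolding lower_minkowski_content_def upper_minkowski_content_def
    by (rule Liminf_le_Limsup) simp
  have low: "lower_minkowski_content s A = 0" if "0 < s" for s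
    using le[of s] up[OF that] by simp
  have inf: "(INF s\<in>{0::real<..}. ereal s) = 0"
  proof (rule INF_eqI)
    fix y assume y: "\<And>i. i \<in> {0<..} \<Longrightarrow> y \<le> ereal i"
    show "y \<le> 0"
      by (rule ereal_le_epsilon2) (use y in auto)
  qed auto
  have "{s. 0 < s \<and> lower_minkowski_content s A = 0} = {0<..}"
       "{s. 0 < s \<and> upper_minkowski_content s A = 0} = {0<..}"
    using low up by auto
  with inf assms(1) show ?thesis
    by (simp add: has_box_dim_def lower_box_dim_def upper_box_dim_def zero_ereal_def)
qed

text \<open>The first \<open>N\<close> points get one ball of radius \<open>2 * e\<close> each. All
  later points lie within \<open>e\<close> of the origin, so a single ball of radius
  \<open>2 * e\<close> about 0 covers their joint neighbourhood.\<close>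

lemma emeasure_eps_nbhd_geometric_le:
  fixes p :: "nat \<Rightarrow> 'a::euclidean_space"
  assumes p: "\<And>n. norm (p n) \<le> C * k ^ n" and k: "0 < k" "k < 1" and "0 < C"
    and e: "0 < e" "e < C"
  shows "emeasure lebesgue (eps_nbhd (range p) e) \<le>
    ennreal ((ln (e / C) / ln k + 2) * (unit_ball_vol (real DIM('a)) * (2 * e) ^ DIM('a)))"
proof -
  define B where "B = unit_ball_vol (real DIM('a)) * (2 * e) ^ DIM('a)"
  \<comment> \<open>\<open>N\<close> solves \<open>C * k ^ N \<le> e\<close>; dividing by the
    negative number \<open>ln k\<close> reverses the inequality. The assumption \<open>e < C\<close>
    makes the quotient nonnegative, so \<open>nat\<close> does not truncate.\<close>
  define N where "N = nat \<lceil>ln (e / C) / ln k\<rceil>"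
  have B0: "0 \<le> B" using e by (simp add: B_def unit_ball_vol_nonneg)
  have lnk: "ln k < 0" using k by simp
  have L0: "0 \<le> ln (e / C) / ln k"
    using e \<open>0 < C\<close> lnk by (intro divide_nonpos_neg) auto
  have NL: "ln (e / C) / ln k \<le> real N" "real N \<le> ln (e / C) / ln k + 1"
    using L0 by (auto simp: N_def)
  have small: "norm (p n) \<le> e" if "N \<le> n" for n
  proof -
    have "ln (e / C) / ln k \<le> real n" using NL(1) that by linarith
    then have "real n * ln k \<le> ln (e / C)"
      using lnk by (simp add: neg_divide_le_eq)
    then have "ln (k ^ n) \<le> ln (e / C)" using k by (simp add: ln_realpow)
    then have "k ^ n \<le> e / C" using k e \<open>0 < C\<close> by simp
    then have "C * k ^ n \<le> e" using \<open>0 < C\<close> by (simp add: field_simps)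
    then show ?thesis using p[of n] by linarith
  qed
  \<comment> \<open>Index \<open>N\<close> is reserved for the ball about the origin, hence
    \<open>N + 1\<close> balls. Together with the rounding up in \<open>N\<close> this gives the
    summand 2 in the bound.\<close>
  have sub: "eps_nbhd (range p) e \<subseteq> (\<Union>n\<in>{..N}. ball (if n < N then p n else 0) (2 * e))"
  proof
    fix y assume "y \<in> eps_nbhd (range p) e"
    then have "infdist y (range p) < e" by (simp add: eps_nbhd_def)
    then obtain n where n: "dist y (p n) < e"
      by (auto simp: infdist_notempty cINF_less_iff)
    show "y \<in> (\<Union>n\<in>{..N}. ball (if n < N then p n else 0) (2 * e))"
    proof (cases "n < N")
      case True
      then show ?thesis using n e by (intro UN_I[of n]) (auto simp: dist_commute)
    next
      case False
      then have "norm (p n) \<le> e" using small by simp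
      then have "dist y 0 < 2 * e" using n dist_triangle[of y 0 "p n"] by simp
      then show ?thesis by (intro UN_I[of N]) auto
    qed
  qed
  have "emeasure lebesgue (eps_nbhd (range p) e)
      \<le> emeasure lebesgue (\<Union>n\<in>{..N}. ball (if n < N then p n else 0) (2 * e))"
    by (rule emeasure_mono[OF sub]) auto
  also have "\<dots> \<le> (\<Sum>n\<in>{..N}. emeasure lebesgue (ball (if n < N then p n else 0) (2 * e)))"
    by (rule emeasure_subadditive_finite) auto
  also have "\<dots> = (\<Sum>n\<in>{..N}. ennreal B)"
    using e by (intro sum.cong) (simp_all add: emeasure_ball B_def)
  also have "\<dots> = ennreal ((real N + 1) * B)"
    using B0 by (subst sum_ennreal) (simp_all add: algebra_simps)
  also have "\<dots> \<le> ennreal ((ln (e / C) / ln k + 2) * B)"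
    using NL(2) B0 by (intro ennreal_leI mult_right_mono) auto
  finally show ?thesis by (simp add: B_def)
qed

text \<open>Dividing the measure bound by \<open>e powr (DIM('a) - s)\<close> leaves a logarithm
  times \<open>e powr s\<close>, which tends to 0 for every \<open>s > 0\<close>.\<close>

lemma has_box_dim_geometric:
  fixes p :: "nat \<Rightarrow> 'a::euclidean_space"
  assumes p: "\<And>n. norm (p n) \<le> C * k ^ n" and k: "0 < k" "k < 1" and "0 < C"
  shows "has_box_dim (range p) 0"
proof (rule has_box_dim_0I)
  have "norm (p n) \<le> C" for n
    using \<open>0 < C\<close> k by (intro order_trans[OF p] mult_left_le power_le_one) auto
  then show "bounded (range p)" by (auto simp: bounded_iff)
next
  fix s :: real assume s: "0 < s"
  define d where "d = DIM('a)"
  define V where "V = unit_ball_vol (real d) * 2 ^ d"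
  define u where "u e = (ln (e / C) / ln k + 2) * V * e powr s" for e
  have u_lim: "(u \<longlongrightarrow> 0) (at_right 0)"
    using s \<open>0 < C\<close> k unfolding u_def by real_asymp
  have ev: "eventually (\<lambda>e. emeasure lebesgue (eps_nbhd (range p) e) /
      ennreal (e powr (real DIM('a) - s)) \<le> ennreal (u e)) (at_right 0)"
    \<comment> \<open>The measure bound is available only for \<open>0 < e < C\<close>, a range that
      contains all sufficiently small positive \<open>e\<close>.\<close>
    using eventually_at_right_less eventually_at_right_real[OF \<open>0 < C\<close>]
  proof eventually_elim
    case (elim e)
    then have e: "0 < e" "e < C" by auto
    define R where "R = (ln (e / C) / ln k + 2) * (unit_ball_vol (real DIM('a)) * (2 * e) ^ DIM('a))"
    have L0: "0 \<le> ln (e / C) / ln k"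
      using e \<open>0 < C\<close> k by (intro divide_nonpos_neg) auto
    have R0: "0 \<le> R" using L0 e by (simp add: R_def unit_ball_vol_nonneg)
    have "e ^ d / e powr (real d - s) = e powr s"
      using e by (simp add: powr_diff powr_realpow)
    then have "R / e powr (real d - s) = u e"
      by (simp add: R_def u_def V_def d_def power_mult_distrib flip: times_divide_eq_right)
    moreover have "emeasure lebesgue (eps_nbhd (range p) e) / ennreal (e powr (real d - s))
        \<le> ennreal R / ennreal (e powr (real d - s))"
      unfolding R_def by (rule divide_right_mono_ennreal)
        (rule emeasure_eps_nbhd_geometric_le[OF p k \<open>0 < C\<close> e])
    ultimately show ?case using e R0 by (simp add: divide_ennreal d_def)
  qed
  have "upper_minkowski_content s (range p) \<le> Limsup (at_right 0) (\<lambda>e. ennreal (u e))"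
    unfolding upper_minkowski_content_def by (rule Limsup_mono[OF ev])
  also have "\<dots> = 0"
    using tendsto_ennrealI[OF u_lim] by (intro lim_imp_Limsup) auto
  finally show "upper_minkowski_content s (range p) = 0" by simp
qed

lemma class_C_near_imp_differentiable:
  assumes "class_C_near r f a" "1 \<le> r"
  shows "f differentiable (at a)"
  using assms by (cases r) (auto simp: class_C_near_def)

lemma vector_2_eq: "(vector [a, b] :: real^2) = a *\<^sub>R axis 1 1 + b *\<^sub>R axis 2 1"
  by (simp add: vec_eq_iff forall_2 axis_def)

lemma norm_vector_2_le: "norm (vector [a, b] :: real^2) \<le> \<bar>a\<bar> + \<bar>b\<bar>"
  unfolding vector_2_eq by (rule norm_triangle_le) simp

text \<open>The curves \<open>(t, 0)\<close> and \<open>(t, h t)\<close> have the same tangent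
  vector at 0. As \<open>f\<close> is totally differentiable there, the chain rule gives it the same
  derivative along both.\<close>

lemma has_derivative_0_along_graph:
  fixes f :: "real^2 \<Rightarrow> real" and h :: "real \<Rightarrow> real"
  assumes f: "f differentiable (at 0)" "((\<lambda>t. f (vector [t, 0])) has_real_derivative 0) (at 0)"
    and h: "h 0 = 0" "(h has_real_derivative 0) (at 0)"
  shows "((\<lambda>t. f (vector [t, h t])) has_real_derivative 0) (at 0)"
proof -
  obtain D where D: "(f has_derivative D) (at 0)"
    using f(1) by (auto simp: differentiable_def)
  have along: "((\<lambda>t. f (vector [t, g t])) has_derivative (\<lambda>t. D (t *\<^sub>R axis 1 1))) (at 0)"
    if g: "g 0 = 0" "(g has_real_derivative 0) (at 0)" for g
  proof -
    have "((\<lambda>t. vector [t, g t] :: real^2) has_derivative (\<lambda>t. t *\<^sub>R axis 1 1)) (at 0)"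
      unfolding vector_2_eq using g(2)
      by (auto intro!: derivative_eq_intros simp: has_field_derivative_def)
    moreover have "(f has_derivative D) (at (vector [0, g 0]))"
      using D g(1) by (simp add: vector_2_eq)
    ultimately show ?thesis by (rule has_derivative_compose)
  qed
  \<comment> \<open>The instance \<open>g = 0\<close> is the axis itself; uniqueness of the
    derivative shows that \<open>D\<close> vanishes in this direction.\<close>
  have "(\<lambda>t. D (t *\<^sub>R axis 1 1)) = (*) 0"
    by (rule has_derivative_unique[OF _ f(2)[unfolded has_field_derivative_def]], rule along) auto
  with along[OF h] show ?thesis by (simp add: has_field_derivative_def)
qed

text \<open>This turns a vanishing derivative into a linear bound with arbitrarily small slope. It
  serves both for the nonlinear part of \<open>G\<close> and for \<open>h\<close>.\<close>

lemma abs_le_near_0_of_DERIV_0: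
  fixes g :: "real \<Rightarrow> real"
  assumes "g 0 = 0" "(g has_real_derivative 0) (at 0)" "0 < c"
  obtains d where "0 < d" "\<And>t. \<bar>t\<bar> < d \<Longrightarrow> \<bar>g t\<bar> \<le> c * \<bar>t\<bar>"
proof -
  have "\<exists>d>0. \<forall>y. norm (y - 0) < d \<longrightarrow> norm (g y - g 0 - 0 * (y - 0)) \<le> c * norm (y - 0)"
    using assms by (auto simp: has_field_derivative_def has_derivative_at_alt)
  with that assms(1) show ?thesis by auto
qed

theorem theorem3:
  fixes F :: "real^2 \<Rightarrow> real^2"
    and f :: "real^2 \<Rightarrow> real"
    and h G :: "real \<Rightarrow> real"
    and lam1 :: real
    and r :: nat
    and U :: "(real^2) set"
    and I :: "real set"
  assumes r: "1 \<le> r"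
    and F: "class_C_near r F 0"
    and hyp: "hyperbolic_fixed_point F 0"
    and eig: "complex_eigenvalue (jacobian F (at 0)) (complex_of_real lam1)" "\<bar>lam1\<bar> < 1"
    and U: "open U" "0 \<in> U"
    and I: "open I" "0 \<in> I"
    and graph: "local_stable_manifold F 0 U = {vector [x, h x] | x. x \<in> I}"
    and h: "class_C_near r h 0" "h 0 = 0" "(h has_real_derivative 0) (at 0)"
    and f: "class_C_near r f 0" "f 0 = 0"
      "((\<lambda>t. f (vector [t, 0])) has_real_derivative 0) (at 0)"
      "((\<lambda>t. f (vector [0, t])) has_real_derivative 0) (at 0)"
    and G: "\<And>x. G x = lam1 * x + f (vector [x, h x])"
    and restriction: "\<And>x. x \<in> I \<Longrightarrow> F (vector [x, h x]) = vector [G x, h (G x)]"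
  shows "\<exists>\<rho>>0. \<forall>x y :: nat \<Rightarrow> real.
           (vector [x 1, y 1] :: real^2) \<in> local_stable_manifold F 0 U \<and>
           y 1 = h (x 1) \<and>
           (\<forall>n\<ge>1. x (n + 1) = lam1 * x n + f (vector [x n, h (x n)]) \<and> y (n + 1) = h (x (n + 1))) \<and>
           norm (vector [x 1, y 1] :: real^2) < \<rho> \<longrightarrow>
           has_box_dim {vector [x n, y n] :: real^2 | n. 1 \<le> n} 0"
proof -
  define g where "g t = f (vector [t, h t])" for t
  have g0: "g 0 = 0" using f(2) h(2) by (simp add: g_def vector_2_eq)
  have g': "(g has_real_derivative 0) (at 0)"
    unfolding g_def
    by (rule has_derivative_0_along_graph)
      (use class_C_near_imp_differentiable[OF f(1) r] f(3) h in auto)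
  \<comment> \<open>The midpoint of \<open>\<bar>lam1\<bar>\<close> and 1 leaves the gap
    \<open>k - \<bar>lam1\<bar>\<close> to absorb the nonlinear term, and it is positive even if
    \<open>lam1 = 0\<close>.\<close>
  define k where "k = (\<bar>lam1\<bar> + 1) / 2"
  have k: "0 < k" "k < 1" "0 < k - \<bar>lam1\<bar>" using eig(2) by (auto simp: k_def)
  obtain d1 where d1: "0 < d1" "\<And>t. \<bar>t\<bar> < d1 \<Longrightarrow> \<bar>g t\<bar> \<le> (k - \<bar>lam1\<bar>) * \<bar>t\<bar>"
    using abs_le_near_0_of_DERIV_0[OF g0 g' k(3)] by blast
  obtain d2 where d2: "0 < d2" "\<And>t. \<bar>t\<bar> < d2 \<Longrightarrow> \<bar>h t\<bar> \<le> 1 * \<bar>t\<bar>"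
    using abs_le_near_0_of_DERIV_0[OF h(2,3) zero_less_one] by blast
  define \<rho> where "\<rho> = min d1 d2"
  have "0 < \<rho>" using d1 d2 by (simp add: \<rho>_def)
  have contr: "\<bar>lam1 * t + g t\<bar> \<le> k * \<bar>t\<bar>" if "\<bar>t\<bar> < \<rho>" for t
  proof -
    have "\<bar>lam1 * t + g t\<bar> \<le> \<bar>lam1\<bar> * \<bar>t\<bar> + \<bar>g t\<bar>"
      using abs_triangle_ineq[of "lam1 * t" "g t"] by (simp add: abs_mult)
    also have "\<dots> \<le> k * \<bar>t\<bar>" using d1(2)[of t] that by (simp add: \<rho>_def algebra_simps)
    finally show ?thesis .
  qed
  show ?thesis
  proof (intro exI[of _ \<rho>] conjI allI impI \<open>0 < \<rho>\<close>, elim conjE)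
    fix x y :: "nat \<Rightarrow> real"
    assume y1: "y 1 = h (x 1)"
      and step: "\<forall>n\<ge>1. x (n + 1) = lam1 * x n + f (vector [x n, h (x n)]) \<and> y (n + 1) = h (x (n + 1))"
      and small: "norm (vector [x 1, y 1] :: real^2) < \<rho>"
    have x1: "\<bar>x 1\<bar> < \<rho>"
      using component_le_norm_cart[of "vector [x 1, y 1] :: real^2" 1] small by simp
    have xk: "\<bar>x (Suc n)\<bar> \<le> \<bar>x 1\<bar> * k ^ n" for n
    proof (induction n)
      case (Suc n)
      \<comment> \<open>The decay bound itself keeps the iterate inside the radius
        \<open>\<rho>\<close>, where \<open>contr\<close> applies again.\<close>
      have "\<bar>x 1\<bar> * k ^ n \<le> \<bar>x 1\<bar>" using k by (intro mult_left_le power_le_one) auto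
      with Suc x1 have "\<bar>x (Suc n)\<bar> < \<rho>" by linarith
      then have "\<bar>x (Suc (Suc n))\<bar> \<le> k * \<bar>x (Suc n)\<bar>"
        using contr step by (auto simp: g_def)
      also have "\<dots> \<le> k * (\<bar>x 1\<bar> * k ^ n)" using Suc k by (intro mult_left_mono) auto
      finally show ?case by (simp add: algebra_simps)
    qed simp
    have y: "y (Suc n) = h (x (Suc n))" for n
      using y1 step by (cases n) auto
    define p where "p n = (vector [x (Suc n), y (Suc n)] :: real^2)" for n
    \<comment> \<open>The factor 2 comes from \<open>\<bar>h t\<bar> \<le> \<bar>t\<bar>\<close>.
      Taking \<open>\<rho>\<close> instead of \<open>\<bar>x 1\<bar>\<close> keeps the constant
      positive also for the orbit that rests at the origin.\<close>
    have "norm (p n) \<le> 2 * \<rho> * k ^ n" for n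
    proof -
      have le: "\<bar>x 1\<bar> * k ^ n \<le> \<bar>x 1\<bar>" using k by (intro mult_left_le power_le_one) auto
      have "\<bar>h (x (Suc n))\<bar> \<le> \<bar>x (Suc n)\<bar>"
        using d2(2)[of "x (Suc n)"] xk[of n] le x1 by (simp add: \<rho>_def)
      then have "norm (p n) \<le> 2 * \<bar>x (Suc n)\<bar>"
        using norm_vector_2_le[of "x (Suc n)" "y (Suc n)"] y[of n] by (simp add: p_def)
      also have "\<dots> \<le> 2 * (\<rho> * k ^ n)"
        using x1 k by (intro mult_left_mono order_trans[OF xk] mult_right_mono) auto
      finally show ?thesis by simp
    qed
    then have "has_box_dim (range p) 0"
      using k \<open>0 < \<rho>\<close> by (intro has_box_dim_geometric[of p "2 * \<rho>" k]) auto
    moreover have "range p = {vector [x n, y n] :: real^2 | n. 1 \<le> n}"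
    proof -
      have "{n. 1 \<le> n} = range Suc" by (auto simp: image_iff Suc_le_eq gr0_conv_Suc)
      then have "{vector [x n, y n] :: real^2 | n. 1 \<le> n} = (\<lambda>n. vector [x n, y n]) ` range Suc"
        by (simp only: setcompr_eq_image)
      then show ?thesis by (simp add: p_def image_image)
    qed
    ultimately show "has_box_dim {vector [x n, y n] :: real^2 | n. 1 \<le> n} 0" by simp
  qed
qed

end
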